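(* Let $(X,\tau)$ be a p-closed topological space. (1) If $(X,\tau)$ is $\aleph_0$-extremally disconnected, then $(X,\tau)$ is nearly compact. (2) If $(X,\tau)$ is extremally disconnected, then $(X,\tau)$ is s-closed.
   Context: No separation axioms are assumed. A subset $A$ of a space $(X,\tau)$ is preopen if $A \subseteq \mathrm{int}(\mathrm{cl}(A))$; it is preclosed if its complement is preopen, i.e. $\mathrm{cl}(\mathrm{int}(A)) \subseteq A$. The preclosure $\mathrm{pcl}(A)$ is the intersection of all preclosed supersets of $A$. $(X,\tau)$ is p-closed if for every cover $\{V_\alpha : \alpha\in A\}$ of $X$ by preopen sets there is a finite $A_0\subseteq A$ with $X=\bigcup_{\alpha\in A_0}\mathrm{pcl}(V_\alpha)$. A set $U$ is regular open if $U=\mathrm{int}(\mathrm{cl}(U))$. $(X,\tau)$ is $\aleph_0$-extremally disconnected if the boundary of every regular open set is finite, and extremally disconnected if the closure of every open set is open. $(X,\tau)$ is nearly compact if every cover of $X$ by regular open sets has a finite subcover. A set $S$ is semi-open if $S\subseteq\mathrm{cl}(\mathrm{int}(S))$ and semi-closed if its complement is semi-open; the semi-closure $\mathrm{scl}(S)$ is the intersection of all semi-closed supersets of $S$. $(X,\tau)$ is s-closed if for every cover $\{V_\alpha:\alpha\in A\}$ of $X$ by semi-open sets there is a finite $A_0\subseteq A$ with $X=\bigcup_{\alpha\in A_0}\mathrm{scl}(V_\alpha)$. *)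

theory Defs
  imports "HOL-Analysis.Analysis"
begin

text \<open>Covers are rendered, as in \<open>compactin\<close>, as sets of subsets of the space rather than as
  indexed families.\<close>

(* "A \<subseteq> topspace X" is implied, since an interior is contained in the space. *)
definition preopenin :: "'a topology \<Rightarrow> 'a set \<Rightarrow> bool" where
  "preopenin X A \<longleftrightarrow> A \<subseteq> X interior_of (X closure_of A)"

definition preclosedin :: "'a topology \<Rightarrow> 'a set \<Rightarrow> bool" where
  "preclosedin X A \<longleftrightarrow> A \<subseteq> topspace X \<and> preopenin X (topspace X - A)"

(* Meaningful for "A \<subseteq> topspace X" only: otherwise no preclosed superset exists and the
   intersection is UNIV. *)
definition preclosure_of :: "'a topology \<Rightarrow> 'a set \<Rightarrow> 'a set" where
  "preclosure_of X A = \<Inter>{C. preclosedin X C \<and> A \<subseteq> C}"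

definition p_closed_space :: "'a topology \<Rightarrow> bool" where
  "p_closed_space X \<longleftrightarrow>
     (\<forall>\<V>. (\<forall>V\<in>\<V>. preopenin X V) \<and> topspace X = \<Union>\<V> \<longrightarrow>
          (\<exists>\<F>. finite \<F> \<and> \<F> \<subseteq> \<V> \<and> topspace X = (\<Union>V\<in>\<F>. preclosure_of X V)))"

definition regular_openin :: "'a topology \<Rightarrow> 'a set \<Rightarrow> bool" where
  "regular_openin X U \<longleftrightarrow> U = X interior_of (X closure_of U)"

definition aleph0_extremally_disconnected_space :: "'a topology \<Rightarrow> bool" where
  "aleph0_extremally_disconnected_space X \<longleftrightarrow>
     (\<forall>U. regular_openin X U \<longrightarrow> finite (X frontier_of U))"

definition extremally_disconnected_space :: "'a topology \<Rightarrow> bool" where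
  "extremally_disconnected_space X \<longleftrightarrow>
     (\<forall>U. openin X U \<longrightarrow> openin X (X closure_of U))"

definition nearly_compact_space :: "'a topology \<Rightarrow> bool" where
  "nearly_compact_space X \<longleftrightarrow>
     (\<forall>\<U>. (\<forall>U\<in>\<U>. regular_openin X U) \<and> topspace X = \<Union>\<U> \<longrightarrow>
          (\<exists>\<F>. finite \<F> \<and> \<F> \<subseteq> \<U> \<and> topspace X = \<Union>\<F>))"

(* As for preopenin, "S \<subseteq> topspace X" is implied. *)
definition semi_openin :: "'a topology \<Rightarrow> 'a set \<Rightarrow> bool" where
  "semi_openin X S \<longleftrightarrow> S \<subseteq> X closure_of (X interior_of S)"

definition semi_closedin :: "'a topology \<Rightarrow> 'a set \<Rightarrow> bool" where
  "semi_closedin X S \<longleftrightarrow> S \<subseteq> topspace X \<and> semi_openin X (topspace X - S)"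

(* As for preclosure_of, meaningful for "S \<subseteq> topspace X" only. *)
definition semi_closure_of :: "'a topology \<Rightarrow> 'a set \<Rightarrow> 'a set" where
  "semi_closure_of X S = \<Inter>{C. semi_closedin X C \<and> S \<subseteq> C}"

definition s_closed_space :: "'a topology \<Rightarrow> bool" where
  "s_closed_space X \<longleftrightarrow>
     (\<forall>\<V>. (\<forall>V\<in>\<V>. semi_openin X V) \<and> topspace X = \<Union>\<V> \<longrightarrow>
          (\<exists>\<F>. finite \<F> \<and> \<F> \<subseteq> \<V> \<and> topspace X = (\<Union>V\<in>\<F>. semi_closure_of X V)))"

end

theory Submission
  imports Defs
begin

text \<open>Closed sets are preclosed, so preclosures lie inside closures, and regular open sets are open,
  hence preopen. Thus p-closedness selects from a regular open cover finitely many members whose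
  closures cover the space. Each closure exceeds its open set by the boundary only; when the
  boundaries are finite, finitely many points are left over, and one further member of the cover for
  each of them completes a finite subcover.

  In an extremally disconnected space every semi-open set is preopen (lemma
  \<open>semi_openin_imp_preopenin\<close>). Hence a semi-open cover is a preopen cover, and by passing to
  complements semi-closed sets are preclosed, so that preclosures are contained in semi-closures.
  The finite family selected by p-closedness therefore also works for s-closedness.\<close>

lemma regular_openin_imp_openin: "regular_openin X U \<Longrightarrow> openin X U"
  unfolding regular_openin_def by (metis openin_interior_of)

lemma openin_imp_preopenin: "openin X U \<Longrightarrow> preopenin X U"
  unfolding preopenin_def
  by (simp add: closure_of_subset interior_of_maximal openin_subset)

lemma preclosure_of_subset_closure_of:
  assumes "A \<subseteq> topspace X"
  shows "preclosure_of X A \<subseteq> X closure_of A"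
proof -
  have "preclosedin X (X closure_of A)"
    unfolding preclosedin_def
    by (simp add: closure_of_subset_topspace openin_imp_preopenin openin_diff)
  then show ?thesis
    unfolding preclosure_of_def using assms closure_of_subset by blast
qed

lemma semi_openin_subset: "semi_openin X S \<Longrightarrow> S \<subseteq> topspace X"
  unfolding semi_openin_def by (erule order_trans) (rule closure_of_subset_topspace)

lemma semi_closure_of_subset_topspace:
  assumes "S \<subseteq> topspace X"
  shows "semi_closure_of X S \<subseteq> topspace X"
proof -
  have "semi_closedin X (topspace X)"
    by (simp add: semi_closedin_def semi_openin_def)
  then show ?thesis
    unfolding semi_closure_of_def using assms by blast
qed

lemma p_closed_space_finite_subfamily:
  assumes "p_closed_space X" "\<And>V. V \<in> \<V> \<Longrightarrow> preopenin X V" "topspace X = \<Union>\<V>"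
  obtains \<F> where "finite \<F>" "\<F> \<subseteq> \<V>" "topspace X = (\<Union>V\<in>\<F>. preclosure_of X V)"
  using assms unfolding p_closed_space_def by meson

lemma p_closed_imp_nearly_compact_space:
  assumes "p_closed_space X" "aleph0_extremally_disconnected_space X"
  shows "nearly_compact_space X"
  unfolding nearly_compact_space_def
proof (intro allI impI, elim conjE)
  fix \<U> assume reg: "\<forall>U\<in>\<U>. regular_openin X U" and cover: "topspace X = \<Union>\<U>"
  have op: "openin X U" if "U \<in> \<U>" for U
    using that reg regular_openin_imp_openin by blast
  obtain \<F> where \<F>: "finite \<F>" "\<F> \<subseteq> \<U>" "topspace X = (\<Union>U\<in>\<F>. preclosure_of X U)"
    using p_closed_space_finite_subfamily[OF assms(1) openin_imp_preopenin[OF op] cover] by metis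
  define R where "R = (\<Union>U\<in>\<F>. X frontier_of U)"
  have "finite (X frontier_of U)" if "U \<in> \<F>" for U
    using assms(2) reg \<F>(2) that unfolding aleph0_extremally_disconnected_space_def by blast
  then have "finite R"
    unfolding R_def using \<F>(1) by blast
  have "R \<subseteq> \<Union>\<U>"
    unfolding R_def using cover frontier_of_subset_topspace by fastforce
  with \<open>finite R\<close> obtain \<G> where \<G>: "finite \<G>" "\<G> \<subseteq> \<U>" "R \<subseteq> \<Union>\<G>"
    by (rule finite_subset_Union)
  have "preclosure_of X U \<subseteq> U \<union> X frontier_of U" if "U \<in> \<F>" for U
  proof -
    have "openin X U"
      using op \<F>(2) that by blast
    then show ?thesis
      using preclosure_of_subset_closure_of[OF openin_subset]
      by (auto simp: frontier_of_def interior_of_openin)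
  qed
  then have "topspace X \<subseteq> \<Union>\<F> \<union> R"
    unfolding \<F>(3) R_def by blast
  then have "topspace X = \<Union>(\<F> \<union> \<G>)"
    using \<F>(2) \<G>(2,3) cover by blast
  then show "\<exists>\<F>. finite \<F> \<and> \<F> \<subseteq> \<U> \<and> topspace X = \<Union>\<F>"
    using \<F>(1,2) \<G>(1,2) by (metis finite_UnI Un_least)
qed

text \<open>The closure of the interior of a semi-open set contains the set and is now itself open, so the
  set lies in the interior of its closure.\<close>

lemma semi_openin_imp_preopenin:
  assumes "extremally_disconnected_space X" "semi_openin X S"
  shows "preopenin X S"
proof -
  have "openin X (X closure_of (X interior_of S))"
    using assms(1) unfolding extremally_disconnected_space_def by simp
  then have "X closure_of (X interior_of S) \<subseteq> X interior_of (X closure_of S)"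
    by (simp add: closure_of_mono interior_of_maximal interior_of_subset)
  then show ?thesis
    using assms(2) unfolding semi_openin_def preopenin_def by blast
qed

lemma preclosure_of_subset_semi_closure_of:
  assumes "extremally_disconnected_space X"
  shows "preclosure_of X S \<subseteq> semi_closure_of X S"
proof -
  have "preclosedin X C" if "semi_closedin X C" for C
    using that semi_openin_imp_preopenin[OF assms]
    unfolding preclosedin_def semi_closedin_def by simp
  then show ?thesis
    unfolding preclosure_of_def semi_closure_of_def by (intro Inf_superset_mono) auto
qed

lemma p_closed_imp_s_closed_space:
  assumes "p_closed_space X" "extremally_disconnected_space X"
  shows "s_closed_space X"
  unfolding s_closed_space_def
proof (intro allI impI, elim conjE)
  fix \<V> assume semi: "\<forall>V\<in>\<V>. semi_openin X V" and cover: "topspace X = \<Union>\<V>"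
  obtain \<F> where \<F>: "finite \<F>" "\<F> \<subseteq> \<V>" "topspace X = (\<Union>V\<in>\<F>. preclosure_of X V)"
    using p_closed_space_finite_subfamily[OF assms(1) _ cover]
      semi_openin_imp_preopenin[OF assms(2)] semi by metis
  have "topspace X = (\<Union>V\<in>\<F>. semi_closure_of X V)"
  proof
    show "topspace X \<subseteq> (\<Union>V\<in>\<F>. semi_closure_of X V)"
      unfolding \<F>(3) using preclosure_of_subset_semi_closure_of[OF assms(2)] by blast
    have "semi_closure_of X V \<subseteq> topspace X" if "V \<in> \<F>" for V
      using that semi \<F>(2) by (intro semi_closure_of_subset_topspace semi_openin_subset) auto
    then show "(\<Union>V\<in>\<F>. semi_closure_of X V) \<subseteq> topspace X"
      by blast
  qed
  then show "\<exists>\<F>. finite \<F> \<and> \<F> \<subseteq> \<V> \<and> topspace X = (\<Union>V\<in>\<F>. semi_closure_of X V)"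
    using \<F>(1,2) by blast
qed

theorem theorem2p6:
  fixes X :: "'a topology"
  assumes "p_closed_space X"
  shows "(aleph0_extremally_disconnected_space X \<longrightarrow> nearly_compact_space X) \<and>
         (extremally_disconnected_space X \<longrightarrow> s_closed_space X)"
  using assms p_closed_imp_nearly_compact_space p_closed_imp_s_closed_space by blast

end
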